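(* Let $f\in\mathcal{K}$ be an entire function of order $\rho(f)\le+\infty$, with associated family $(X_t)_{t\ge 0}$. Then $$\limsup_{t\to\infty}\frac{\ln\big[\mathbf{E}(X_t^p)^{1/p}\big]}{\ln t}=\rho(f),\qquad\text{for any } p\ge 1.$$
   Context: $\mathcal{K}$ is the class of nonconstant power series $f(z)=\sum_{n=0}^\infty a_nz^n$ with positive radius of convergence $R\le\infty$, with all $a_n\ge 0$ and with $a_0>0$; $f$ entire means $R=\infty$. The associated (Khinchin) family $(X_t)_{t\ge 0}$ of an entire $f\in\mathcal{K}$ consists of random variables with values in $\{0,1,2,\dots\}$, with $X_0\equiv 0$ and $\mathbf{P}(X_t=n)=a_nt^n/f(t)$ for $t>0$, $n\ge 0$. $\mathbf{E}$ denotes expectation. The order of an entire $f\in\mathcal{K}$ is $\rho(f)=\limsup_{t\to\infty}\frac{\ln\ln\max_{|z|=t}|f(z)|}{\ln t}=\limsup_{t\to\infty}\frac{\ln\ln f(t)}{\ln t}\in[0,+\infty]$. *)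

theory Defs
  imports "HOL-Probability.Probability"
begin

definition class_K :: "real fps set" where
  "class_K = {f. (\<exists>n>0. fps_nth f n \<noteq> 0) \<and> fps_conv_radius f > 0 \<and>
                 (\<forall>n. fps_nth f n \<ge> 0) \<and> fps_nth f 0 > 0}"

definition entire_fps :: "real fps \<Rightarrow> bool" where
  "entire_fps f \<longleftrightarrow> fps_conv_radius f = \<infinity>"

definition complex_fun :: "real fps \<Rightarrow> complex \<Rightarrow> complex" where
  "complex_fun f = eval_fps (Abs_fps (\<lambda>n. complex_of_real (fps_nth f n)))"

(* For continuous F and t >= 0 the supremum over the compact circle is attained. *)
definition max_modulus :: "(complex \<Rightarrow> complex) \<Rightarrow> real \<Rightarrow> real" where
  "max_modulus F t = (SUP z\<in>sphere 0 t. cmod (F z))"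

definition order_entire :: "(complex \<Rightarrow> complex) \<Rightarrow> ereal" where
  "order_entire F = Limsup at_top (\<lambda>t::real. ereal (ln (ln (max_modulus F t)) / ln t))"

(* Only the law of each X t is prescribed, so no joint distribution is assumed: the X t may
   live on different probability spaces M t (a common space is the case of constant M). *)
definition khinchin_family ::
  "real fps \<Rightarrow> (real \<Rightarrow> 'w measure) \<Rightarrow> (real \<Rightarrow> 'w \<Rightarrow> nat) \<Rightarrow> bool" where
  "khinchin_family f M X \<longleftrightarrow>
     (\<forall>t\<ge>0. prob_space (M t) \<and> X t \<in> measurable (M t) (count_space UNIV)) \<and>
     (\<forall>w\<in>space (M 0). X 0 w = 0) \<and>
     (\<forall>t>0. \<forall>n. measure (M t) {w \<in> space (M t). X t w = n} =
                   fps_nth f n * t ^ n / eval_fps f t)"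

end

theory Submission
  imports Defs "HOL-Real_Asymp.Real_Asymp"
begin

text \<open>Upper bound: the exponential moment of \<open>X\<^sub>t\<close> is \<open>f(et)/f(t)\<close>, and
  \<open>x\<^sup>p \<le> K\<^sup>p + C e\<^sup>-\<^sup>K\<^sup>/\<^sup>2 e\<^sup>x\<close> for every \<open>K > 0\<close>. If \<open>ln f(t) \<le> t\<^sup>\<sigma>\<close> eventually, then
  \<open>K = 2 (et)\<^sup>\<sigma>\<close> makes the second term bounded in expectation, so the \<open>p\<close>-norm of \<open>X\<^sub>t\<close> is \<open>O(t\<^sup>\<sigma>)\<close>.
  Lower bound: the mean of \<open>X\<^sub>t\<close> is \<open>t f'(t)/f(t)\<close>, so a bound \<open>O(t\<^sup>\<sigma>)\<close> with \<open>\<sigma> > 0\<close> on the \<open>p\<close>-norm,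
  hence on the mean, integrates to \<open>ln f(t) = O(t\<^sup>\<sigma>)\<close>.\<close>

section \<open>Comparison of growth exponents\<close>

text \<open>The lower bound \<open>c\<close> forces the right-hand side to be nonnegative, so that only
  exponents \<open>\<sigma> > 0\<close> have to be considered.\<close>

lemma Limsup_ln_div_ln_le:
  fixes u v :: "real \<Rightarrow> real"
  assumes c: "c > 0" "\<forall>\<^sub>F t in at_top. u t \<ge> c"
    and v: "\<forall>\<^sub>F t in at_top. v t > 0"
    and uv: "\<And>\<sigma>. \<sigma> > 0 \<Longrightarrow> \<forall>\<^sub>F t in at_top. u t \<le> t powr \<sigma> \<Longrightarrow>
      \<exists>C. \<forall>\<^sub>F t in at_top. v t \<le> C * t powr \<sigma>"
  shows "Limsup at_top (\<lambda>t. ereal (ln (v t) / ln t)) \<le> Limsup at_top (\<lambda>t. ereal (ln (u t) / ln t))"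
    (is "?V \<le> ?U")
proof (rule dense_ge)
  \<comment> \<open>Bounding \<open>?V\<close> by every \<open>y\<close> above \<open>?U\<close>
    also covers \<open>?U\<close> infinite, where no such \<open>y\<close> exists. The real \<sigma>
    in between is the exponent given to \<open>uv\<close>.\<close>
  fix y assume y: "?U < y"
  then obtain \<sigma> where \<sigma>: "?U < ereal \<sigma>" "ereal \<sigma> < y"
    using ereal_dense2 by blast
  have "((\<lambda>t. ereal (ln c / ln t)) \<longlongrightarrow> ereal 0) at_top"
    by (rule tendsto_ereal) real_asymp
  then have "ereal 0 = Limsup at_top (\<lambda>t. ereal (ln c / ln t))"
    by (intro lim_imp_Limsup[symmetric]) simp_all
  also have "\<dots> \<le> ?U"
  proof (rule Limsup_mono)
    show "\<forall>\<^sub>F t in at_top. ereal (ln c / ln t) \<le> ereal (ln (u t) / ln t)"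
      using c(2) eventually_gt_at_top[of 1]
      by eventually_elim (use c(1) in \<open>auto intro!: divide_right_mono\<close>)
  qed
  finally have "\<sigma> > 0"
    using \<sigma>(1) by (metis ereal_less(2) order.strict_trans1 zero_ereal_def)
  have "\<forall>\<^sub>F t in at_top. ereal (ln (u t) / ln t) < ereal \<sigma>"
    using \<sigma>(1) by (metis Limsup_le_iff order_refl)
  then have "\<forall>\<^sub>F t in at_top. u t \<le> t powr \<sigma>"
    using c(2) eventually_gt_at_top[of 1]
  proof eventually_elim
    case (elim t)
    then have "ln (u t) < ln (t powr \<sigma>)"
      by (simp add: divide_less_eq ln_powr)
    then show ?case
      using elim c(1) by (subst (asm) ln_less_cancel_iff) auto
  qed
  from uv[OF \<open>\<sigma> > 0\<close> this] obtain C where C: "\<forall>\<^sub>F t in at_top. v t \<le> C * t powr \<sigma>" ..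
  \<comment> \<open>The maximum with 1 makes the constant visibly positive, so its logarithm splits
    off; \<open>ln D / ln t\<close> then tends to 0 and leaves the exponent \<sigma> alone.\<close>
  define D where "D = max C 1"
  have "((\<lambda>t. ereal (ln D / ln t + \<sigma>)) \<longlongrightarrow> ereal \<sigma>) at_top"
    by (rule tendsto_ereal) real_asymp
  then have "Limsup at_top (\<lambda>t. ereal (ln D / ln t + \<sigma>)) = ereal \<sigma>"
    by (intro lim_imp_Limsup) simp_all
  moreover have "?V \<le> Limsup at_top (\<lambda>t. ereal (ln D / ln t + \<sigma>))"
  proof (rule Limsup_mono)
    show "\<forall>\<^sub>F t in at_top. ereal (ln (v t) / ln t) \<le> ereal (ln D / ln t + \<sigma>)"
      using C v eventually_gt_at_top[of 1]
    proof eventually_elim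
      case (elim t)
      have "v t \<le> D * t powr \<sigma>"
        using elim(1) by (rule order_trans) (auto simp: D_def intro!: mult_right_mono)
      then have "ln (v t) \<le> ln (D * t powr \<sigma>)"
        using elim(2) by simp
      also have "\<dots> = ln D + \<sigma> * ln t"
        using elim(3) by (simp add: D_def ln_mult ln_powr)
      finally show ?case
        using elim(3) by (simp add: field_simps)
    qed
  qed
  ultimately show "?V \<le> y"
    using \<sigma>(2) by simp
qed

section \<open>Expectations as series and an exponential bound\<close>

text \<open>The law of \<open>X\<close> has density \<open>P\<close> with respect to counting
  measure on the naturals, so the integral becomes a series; absolute summability is exactly
  integrability there.\<close>

lemma (in prob_space) expectation_nat_sums:
  fixes X :: "'a \<Rightarrow> nat" and g :: "nat \<Rightarrow> real"
  assumes X[measurable]: "X \<in> measurable M (count_space UNIV)"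
    and summ: "summable (\<lambda>n. \<bar>g n\<bar> * prob {w \<in> space M. X w = n})"
  shows "integrable M (\<lambda>w. g (X w))"
    and "(\<lambda>n. g n * prob {w \<in> space M. X w = n}) sums expectation (\<lambda>w. g (X w))"
proof -
  define P where "P n = prob {w \<in> space M. X w = n}" for n
  have distr: "distr M (count_space UNIV) X = density (count_space UNIV) (\<lambda>n. ennreal (P n))"
  proof (rule measure_eqI_countable[where A = UNIV])
    fix n :: nat
    have "emeasure (distr M (count_space UNIV) X) {n} = emeasure M (X -` {n} \<inter> space M)"
      by (subst emeasure_distr) auto
    also have "X -` {n} \<inter> space M = {w \<in> space M. X w = n}"
      by auto
    finally show "emeasure (distr M (count_space UNIV) X) {n} =
        emeasure (density (count_space UNIV) (\<lambda>n. ennreal (P n))) {n}"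
      by (simp add: emeasure_density P_def emeasure_eq_measure nn_integral_count_space_indicator[symmetric]
          nn_integral_count_space_finite)
  qed auto
  have int: "integrable (count_space UNIV) (\<lambda>n. P n * g n)"
    using summ by (simp add: integrable_count_space_nat_iff abs_mult P_def mult.commute)
  have "integrable (distr M (count_space UNIV) X) g"
    unfolding distr using int
    by (subst integrable_density) (auto simp: P_def)
  then show "integrable M (\<lambda>w. g (X w))"
    by (simp add: integrable_distr_eq)
  have "expectation (\<lambda>w. g (X w)) = integral\<^sup>L (distr M (count_space UNIV) X) g"
    by (subst integral_distr) auto
  also have "\<dots> = integral\<^sup>L (count_space UNIV) (\<lambda>n. P n * g n)"
    unfolding distr by (subst integral_density) (auto simp: P_def)
  finally show "(\<lambda>n. g n * prob {w \<in> space M. X w = n}) sums expectation (\<lambda>w. g (X w))"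
    using sums_integral_count_space_nat[OF int] by (simp add: P_def mult.commute)
qed

text \<open>The rate 1/2 in place of 1 keeps a factor \<open>exp (n / 2)\<close> in reserve, which
  truncation at level \<open>K\<close> turns into the decay \<open>exp (- K / 2)\<close>.\<close>

lemma powr_le_exp_half:
  fixes p :: real
  obtains C where "C > 0" "\<And>n::nat. real n powr p \<le> C * exp (real n / 2)"
proof -
  have "(\<lambda>n::nat. real n powr p * exp (- real n / 2)) \<longlonglongrightarrow> 0"
    by real_asymp
  then have "Bseq (\<lambda>n::nat. real n powr p * exp (- real n / 2))"
    by (meson convergentI convergent_imp_Bseq)
  then obtain C where "C > 0" "\<And>n::nat. norm (real n powr p * exp (- real n / 2)) \<le> C"
    by (auto elim!: BseqE)
  then have "real n powr p \<le> C * exp (real n / 2)" for n :: nat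
    by (simp add: exp_minus field_simps)
  with \<open>C > 0\<close> show ?thesis
    using that by blast
qed

section \<open>Entire functions with nonnegative coefficients\<close>

locale entire_class_K =
  fixes f :: "real fps"
  assumes class_K: "f \<in> class_K" and entire: "entire_fps f"
begin

lemma coeff_nonneg: "fps_nth f n \<ge> 0" and coeff_0_pos: "fps_nth f 0 > 0"
  using class_K unfolding class_K_def by blast+

lemma sums_eval: "(\<lambda>n. fps_nth f n * t ^ n) sums eval_fps f t"
  using entire by (intro sums_eval_fps) (simp add: entire_fps_def)

lemma term_le_eval:
  assumes "t \<ge> 0"
  shows "fps_nth f k * t ^ k \<le> eval_fps f t"
proof -
  have "(\<Sum>n\<in>{k}. fps_nth f n * t ^ n) \<le> (\<Sum>n. fps_nth f n * t ^ n)"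
    using assms coeff_nonneg by (intro sum_le_suminf sums_summable[OF sums_eval]) auto
  then show ?thesis
    by (simp add: eval_fps_def)
qed

lemma coeff_0_le_eval: "t \<ge> 0 \<Longrightarrow> fps_nth f 0 \<le> eval_fps f t"
  using term_le_eval[of t 0] by simp

lemma eval_pos: "t \<ge> 0 \<Longrightarrow> eval_fps f t > 0"
  using coeff_0_le_eval[of t] coeff_0_pos by simp

text \<open>As \<open>f\<close> is nonconstant, some coefficient of positive index is positive, and
  its monomial alone, a lower bound for \<open>f\<close>, tends to infinity.\<close>

lemma eventually_eval_ge: "\<forall>\<^sub>F t in at_top. eval_fps f t \<ge> c"
proof -
  obtain k where "k > 0" "fps_nth f k \<noteq> 0"
    using class_K unfolding class_K_def by blast
  then have k: "k > 0" "fps_nth f k > 0"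
    using coeff_nonneg[of k] by auto
  have "filterlim (\<lambda>t. fps_nth f k * t ^ k) at_top at_top"
    using k by (intro filterlim_tendsto_pos_mult_at_top[OF tendsto_const] filterlim_pow_at_top filterlim_ident)
  then have "\<forall>\<^sub>F t in at_top. fps_nth f k * t ^ k \<ge> c"
    by (simp add: filterlim_at_top)
  then show ?thesis
    using eventually_ge_at_top[of 0]
    by eventually_elim (use term_le_eval order_trans in blast)
qed

text \<open>The triangle inequality bounds the modulus by \<open>f(t)\<close>, and nonnegativity of
  the coefficients gives equality at the point z = t of the circle.\<close>

lemma max_modulus_eq:
  assumes "t \<ge> 0"
  shows "max_modulus (complex_fun f) t = eval_fps f t"
proof -
  have summ: "summable (\<lambda>n. fps_nth f n * t ^ n)"
    using sums_eval sums_summable by blast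
  have le: "cmod (complex_fun f z) \<le> eval_fps f t" if "z \<in> sphere 0 t" for z
  proof -
    have eq: "norm (complex_of_real (fps_nth f n) * z ^ n) = fps_nth f n * t ^ n" for n
      using that coeff_nonneg by (simp add: norm_mult norm_power)
    have "cmod (complex_fun f z) \<le> (\<Sum>n. norm (complex_of_real (fps_nth f n) * z ^ n))"
      unfolding complex_fun_def eval_fps_def fps_nth_Abs_fps
      by (rule summable_norm) (simp add: eq summ)
    also have "\<dots> = eval_fps f t"
      unfolding eq eval_fps_def ..
    finally show ?thesis .
  qed
  have at: "complex_fun f (of_real t) = of_real (eval_fps f t)"
    using sums_of_real[OF sums_eval, of t, where 'a = complex]
    by (simp add: complex_fun_def eval_fps_def sums_iff)
  show ?thesis
    unfolding max_modulus_def
  proof (rule cSup_eq_maximum)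
    show "eval_fps f t \<in> (\<lambda>z. cmod (complex_fun f z)) ` sphere 0 t"
      using assms eval_pos[OF assms] at by (intro image_eqI[of _ _ "of_real t"]) auto
  qed (use le in auto)
qed

lemma order_entire_eq:
  "order_entire (complex_fun f) = Limsup at_top (\<lambda>t. ereal (ln (ln (eval_fps f t)) / ln t))"
  unfolding order_entire_def
proof (rule Limsup_eq)
  show "\<forall>\<^sub>F t in at_top. ereal (ln (ln (max_modulus (complex_fun f) t)) / ln t)
      = ereal (ln (ln (eval_fps f t)) / ln t)"
    using eventually_ge_at_top[of 0] by eventually_elim (simp add: max_modulus_eq)
qed

text \<open>Dividing this series by \<open>f(t)\<close> gives the mean of \<open>X t\<close>. The
  factor \<open>t\<close> undoes the index shift of the derivative, and the term at n = 0
  vanishes.\<close>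

lemma sums_deriv: "(\<lambda>n. real n * fps_nth f n * t ^ n) sums (t * eval_fps (fps_deriv f) t)"
proof -
  have "fps_conv_radius (fps_deriv f) = \<infinity>"
    using fps_conv_radius_deriv[of f] entire by (simp add: entire_fps_def)
  then have "(\<lambda>n. fps_nth (fps_deriv f) n * t ^ n) sums eval_fps (fps_deriv f) t"
    by (intro sums_eval_fps) simp
  from sums_mult[OF this, of t]
  have "(\<lambda>n. real (Suc n) * fps_nth f (Suc n) * t ^ Suc n) sums (t * eval_fps (fps_deriv f) t)"
    by (simp add: algebra_simps)
  then show ?thesis
    by (subst (asm) sums_Suc_iff) simp
qed

end

section \<open>Moments of the Khinchin family\<close>

locale entire_khinchin_family = entire_class_K f
  for f +
  fixes M :: "real \<Rightarrow> 'w measure" and X :: "real \<Rightarrow> 'w \<Rightarrow> nat"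
  assumes khinchin: "khinchin_family f M X"
begin

text \<open>For nonnegative \<open>g\<close>, convergence of the unnormalised series is already
  absolute, so one \<open>sums\<close> fact yields both integrability and the value. It is applied
  to the mean and to the exponential moment.\<close>

lemma
  fixes t :: real and g :: "nat \<Rightarrow> real"
  assumes t: "t > 0" and g: "\<And>n. g n \<ge> 0" and S: "(\<lambda>n. g n * fps_nth f n * t ^ n) sums S"
  shows integrable_khinchin: "integrable (M t) (\<lambda>w. g (X t w))"
    and expectation_khinchin: "integral\<^sup>L (M t) (\<lambda>w. g (X t w)) = S / eval_fps f t"
proof -
  interpret prob_space "M t"
    using khinchin t by (simp add: khinchin_family_def)
  have X: "X t \<in> measurable (M t) (count_space UNIV)"
    using khinchin t by (simp add: khinchin_family_def)
  have P: "prob {w \<in> space (M t). X t w = n} = fps_nth f n * t ^ n / eval_fps f t" for n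
    using khinchin t by (simp add: khinchin_family_def)
  have sums: "(\<lambda>n. g n * prob {w \<in> space (M t). X t w = n}) sums (S / eval_fps f t)"
    using sums_divide[OF S, of "eval_fps f t"] by (simp add: P mult.assoc)
  have "summable (\<lambda>n. \<bar>g n\<bar> * prob {w \<in> space (M t). X t w = n})"
    using sums_summable[OF sums] g by simp
  note * = expectation_nat_sums[OF X this]
  show "integrable (M t) (\<lambda>w. g (X t w))"
    by (rule *)
  show "expectation (\<lambda>w. g (X t w)) = S / eval_fps f t"
    using sums_unique2[OF *(2) sums] .
qed

lemmas integrable_mean = integrable_khinchin[where g = real, OF _ _ sums_deriv, simplified]
  and expectation_mean = expectation_khinchin[where g = real, OF _ _ sums_deriv, simplified]

text \<open>The factor \<open>exp n\<close> merges with \<open>t ^ n\<close> into the n-th power of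
  e t, where the series still converges since \<open>f\<close> is entire.\<close>

lemma sums_exp: "(\<lambda>n. exp (real n) * fps_nth f n * t ^ n) sums eval_fps f (exp 1 * t)"
proof -
  have "fps_nth f n * (exp 1 * t) ^ n = exp (real n) * fps_nth f n * t ^ n" for n
    using exp_of_nat_mult[of n "1 :: real"] by (simp add: power_mult_distrib)
  with sums_eval[of "exp 1 * t"] show ?thesis
    by simp
qed

lemmas integrable_exp = integrable_khinchin[where g = "\<lambda>n. exp (real n)", OF _ _ sums_exp, simplified]
  and expectation_exp = expectation_khinchin[where g = "\<lambda>n. exp (real n)", OF _ _ sums_exp, simplified]

lemma integrable_powr:
  assumes t: "t > 0"
  shows "integrable (M t) (\<lambda>w. real (X t w) powr p)"
proof -
  obtain C where C: "C > 0" "\<And>n::nat. real n powr p \<le> C * exp (real n / 2)"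
    using powr_le_exp_half by blast
  have X[measurable]: "X t \<in> measurable (M t) (count_space UNIV)"
    using khinchin t by (simp add: khinchin_family_def)
  have "real n powr p \<le> C * exp (real n)" for n :: nat
    using C(2)[of n] by (rule order_trans) (use C(1) in auto)
  then show ?thesis
    by (intro Bochner_Integration.integrable_bound[OF integrable_mult_right[OF integrable_exp[OF t], of C]])
      (use C(1) in auto)
qed

text \<open>Values of \<open>X t\<close> up to \<open>K\<close> contribute at most
  \<open>K powr p\<close>; larger ones are charged to the exponential moment. \<open>C\<close> is
  fixed before \<open>t\<close> and \<open>K\<close>, so \<open>K\<close> may later depend on
  \<open>t\<close>.\<close>

lemma moment_le_truncation:
  assumes "p \<ge> 1"
  obtains C where "C > 0" "\<And>t K. t > 0 \<Longrightarrow> K > 0 \<Longrightarrow>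
    integral\<^sup>L (M t) (\<lambda>w. real (X t w) powr p)
      \<le> K powr p + C * exp (- K / 2) * (eval_fps f (exp 1 * t) / eval_fps f t)"
proof -
  obtain C where C: "C > 0" "\<And>n::nat. real n powr p \<le> C * exp (real n / 2)"
    using powr_le_exp_half by blast
  have bound: "real n powr p \<le> K powr p + C * exp (- K / 2) * exp (real n)" if "K > 0" for K and n :: nat
  proof (cases "real n \<le> K")
    case True
    then have "real n powr p \<le> K powr p"
      using assms by (intro powr_mono2) auto
    then show ?thesis
      using C(1) by (simp add: add_increasing2)
  next
    case False
    have "real n powr p \<le> C * exp (real n / 2)"
      by (rule C)
    \<comment> \<open>For n > K one has n / 2 < n - K / 2.\<close>
    also have "\<dots> \<le> C * exp (- K / 2 + real n)"
      using False C(1) by simp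
    also have "\<dots> \<le> K powr p + C * exp (- K / 2) * exp (real n)"
      by (simp add: mult.assoc flip: exp_add)
    finally show ?thesis .
  qed
  show ?thesis
  proof (rule that[OF C(1)])
    fix t K :: real
    assume t: "t > 0" and K: "K > 0"
    interpret prob_space "M t"
      using khinchin t by (simp add: khinchin_family_def)
    have "expectation (\<lambda>w. real (X t w) powr p)
        \<le> expectation (\<lambda>w. K powr p + C * exp (- K / 2) * exp (real (X t w)))"
      using bound[OF K] integrable_exp[OF t]
      by (intro integral_mono integrable_powr t) auto
    also have "\<dots> = K powr p + C * exp (- K / 2) * (eval_fps f (exp 1 * t) / eval_fps f t)"
      using integrable_exp[OF t] by (simp add: expectation_exp[OF t] prob_space)
    finally show "expectation (\<lambda>w. real (X t w) powr p)
      \<le> K powr p + C * exp (- K / 2) * (eval_fps f (exp 1 * t) / eval_fps f t)" .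
  qed
qed

section \<open>Comparison of the mean with the p-norm\<close>

text \<open>Since \<open>X t\<close> is integer-valued, x \<le> x^p holds at every value, including
  0. This serves to pass positivity from the mean to the p-th moment.\<close>

lemma mean_le_moment:
  assumes t: "t > 0" and p: "p \<ge> 1"
  shows "integral\<^sup>L (M t) (\<lambda>w. real (X t w)) \<le> integral\<^sup>L (M t) (\<lambda>w. real (X t w) powr p)"
proof (intro integral_mono integrable_mean integrable_powr t)
  fix w
  show "real (X t w) \<le> real (X t w) powr p"
    using powr_mono[OF p, of "real (X t w)"] by (cases "X t w = 0") auto
qed

lemma mean_le_root_moment:
  assumes t: "t > 0" and p: "p \<ge> 1" and pos: "integral\<^sup>L (M t) (\<lambda>w. real (X t w)) > 0"
  shows "integral\<^sup>L (M t) (\<lambda>w. real (X t w))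
    \<le> 2 * integral\<^sup>L (M t) (\<lambda>w. real (X t w) powr p) powr (1 / p)"
proof -
  interpret prob_space "M t"
    using khinchin t by (simp add: khinchin_family_def)
  define E where "E = expectation (\<lambda>w. real (X t w) powr p)"
  define A where "A = E powr (1 / p)"
  \<comment> \<open>Positivity matters: for A = 0 the term \<open>A powr (1 - p)\<close> would take
    the default value 0 and the pointwise bound below would fail.\<close>
  have E: "E > 0"
    using mean_le_moment[OF t p] pos by (simp add: E_def)
  then have A: "A > 0" and AE: "A powr p = E"
    using p by (auto simp: A_def powr_powr)
  \<comment> \<open>Jensen's inequality up to a factor 2, which does not affect the growth exponent\<close>
  have le: "x \<le> A + A powr (1 - p) * x powr p" if "x \<ge> 0" for x
  proof (cases "x \<le> A")
    case False
    \<comment> \<open>Above \<open>A\<close>, write x as x^(1-p) * x^p and use that the exponent 1 -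
      p is at most 0.\<close>
    then have "x powr (1 - p) \<le> A powr (1 - p)"
      using A p by (intro powr_mono2') auto
    then have "x powr (1 - p) * x powr p \<le> A powr (1 - p) * x powr p"
      by (intro mult_right_mono) auto
    then have "x \<le> A powr (1 - p) * x powr p"
      using False A by (simp add: powr_add[symmetric])
    then show ?thesis
      using A by simp
  qed (simp add: add_increasing2)
  have "expectation (\<lambda>w. real (X t w)) \<le> expectation (\<lambda>w. A + A powr (1 - p) * real (X t w) powr p)"
    using le integrable_powr[OF t, of p] by (intro integral_mono integrable_mean t) auto
  also have "\<dots> = A + A powr (1 - p) * E"
    using integrable_powr[OF t, of p] by (simp add: E_def prob_space)
  also have "\<dots> = 2 * A"
    using A by (simp add: AE[symmetric] powr_add[symmetric])
  finally show ?thesis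
    by (simp add: A_def E_def)
qed

text \<open>The mean is at least the probability that \<open>X t\<close> is nonzero, which is 1 -
  a_0 / f(t); this is at least 1/2 once f(t) \<ge> 2 a_0.\<close>

lemma eventually_mean_ge: "\<forall>\<^sub>F t in at_top. integral\<^sup>L (M t) (\<lambda>w. real (X t w)) \<ge> 1 / 2"
  using eventually_eval_ge[of "2 * fps_nth f 0"] eventually_gt_at_top[of 0]
proof eventually_elim
  case (elim t)
  have "(\<lambda>n. fps_nth f n * t ^ n - (if n = 0 then fps_nth f 0 else 0)) sums (eval_fps f t - fps_nth f 0)"
    using sums_diff[OF sums_eval sums_single[of 0 "\<lambda>_. fps_nth f 0"]] by simp
  moreover have "fps_nth f n * t ^ n - (if n = 0 then fps_nth f 0 else 0) \<le> real n * fps_nth f n * t ^ n" for n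
    using elim coeff_nonneg[of n] mult_right_mono[of 1 "real n" "fps_nth f n * t ^ n"]
    by (cases "n = 0") (auto simp: mult.assoc)
  ultimately have "eval_fps f t - fps_nth f 0 \<le> t * eval_fps (fps_deriv f) t"
    by (intro sums_le[OF _ _ sums_deriv])
  then show ?case
    using elim eval_pos[of t] by (simp add: expectation_mean field_simps)
qed

section \<open>Transfer of power bounds between the p-norm and \<open>ln f\<close>\<close>

lemma root_moment_growth:
  assumes p: "p \<ge> 1" and \<sigma>: "\<sigma> > 0"
    and growth: "\<forall>\<^sub>F t in at_top. ln (eval_fps f t) \<le> t powr \<sigma>"
  shows "\<exists>C. \<forall>\<^sub>F t in at_top.
    integral\<^sup>L (M t) (\<lambda>w. real (X t w) powr p) powr (1 / p) \<le> C * t powr \<sigma>"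
proof -
  obtain C where C: "C > 0" "\<And>t K. t > 0 \<Longrightarrow> K > 0 \<Longrightarrow>
    integral\<^sup>L (M t) (\<lambda>w. real (X t w) powr p)
      \<le> K powr p + C * exp (- K / 2) * (eval_fps f (exp 1 * t) / eval_fps f t)"
    using moment_le_truncation[OF p] by blast
  \<comment> \<open>The 1 accounts for the truncated part, and \<open>C / fps_nth f 0\<close> for
    the tail, where \<open>f(t)\<close> is bounded below by its constant coefficient.\<close>
  define D where "D = 1 + C / fps_nth f 0"
  have "filterlim (\<lambda>t::real. exp 1 * t) at_top at_top"
    by real_asymp
  from growth[THEN eventually_compose_filterlim, OF this] eventually_ge_at_top[of 1]
  have "\<forall>\<^sub>F t in at_top. integral\<^sup>L (M t) (\<lambda>w. real (X t w) powr p) powr (1 / p)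
      \<le> (D powr (1 / p) * 2 * exp 1 powr \<sigma>) * t powr \<sigma>"
  proof eventually_elim
    case (elim t)
    \<comment> \<open>The growth hypothesis at e t reads f(e t) \<le> exp (K / 2), which cancels the
      factor \<open>exp (- K / 2)\<close> of the tail.\<close>
    define K where "K = 2 * (exp 1 * t) powr \<sigma>"
    have "exp 1 * t \<ge> 1"
      using elim(2) mult_mono[of 1 "exp 1" 1 t] by simp
    \<comment> \<open>This allows the constant tail bound to be absorbed into a multiple of
      \<open>K powr p\<close>.\<close>
    then have K: "K \<ge> 1"
      using \<sigma> ge_one_powr_ge_zero[of "exp 1 * t" \<sigma>] by (simp add: K_def)
    have D: "D \<ge> 0"
      using C(1) coeff_0_pos by (simp add: D_def)
    have "eval_fps f (exp 1 * t) = exp (ln (eval_fps f (exp 1 * t)))"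
      using elim eval_pos[of "exp 1 * t"] by simp
    also have "\<dots> \<le> exp (K / 2)"
      using elim by (simp add: K_def)
    finally have "eval_fps f (exp 1 * t) / eval_fps f t \<le> exp (K / 2) / fps_nth f 0"
      using elim coeff_0_pos coeff_0_le_eval[of t] by (intro frac_le) auto
    then have "C * exp (- K / 2) * (eval_fps f (exp 1 * t) / eval_fps f t)
        \<le> C * exp (- K / 2) * (exp (K / 2) / fps_nth f 0)"
      using C(1) by (intro mult_left_mono) auto
    also have "\<dots> = C / fps_nth f 0"
      by (simp add: exp_minus)
    also have "\<dots> \<le> C / fps_nth f 0 * K powr p"
      using C(1) coeff_0_pos K p mult_left_mono[OF ge_one_powr_ge_zero[of K p], of "C / fps_nth f 0"]
      by simp
    finally have "integral\<^sup>L (M t) (\<lambda>w. real (X t w) powr p) \<le> D * K powr p"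
      using C(2)[of t K] elim K by (simp add: D_def algebra_simps)
    then have "integral\<^sup>L (M t) (\<lambda>w. real (X t w) powr p) powr (1 / p) \<le> (D * K powr p) powr (1 / p)"
      using p by (intro powr_mono2) auto
    also have "\<dots> = D powr (1 / p) * K"
      using p K D by (simp add: powr_mult powr_powr)
    finally show ?case
      using elim by (simp add: K_def powr_mult mult_ac)
  qed
  then show ?thesis ..
qed

text \<open>The logarithmic derivative of \<open>f\<close> at t is the mean of \<open>X t\<close>
  divided by t, hence at most 2 t^(\<sigma>-1) for large t. Instead of integrating, the proof shows
  that \<open>ln f\<close> minus the antiderivative (2/\<sigma>) t^\<sigma> is
  nonincreasing.\<close>

lemma ln_eval_growth:
  assumes p: "p \<ge> 1" and \<sigma>: "\<sigma> > 0"
    and growth: "\<forall>\<^sub>F t in at_top.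
      integral\<^sup>L (M t) (\<lambda>w. real (X t w) powr p) powr (1 / p) \<le> t powr \<sigma>"
  shows "\<exists>C. \<forall>\<^sub>F t in at_top. ln (eval_fps f t) \<le> C * t powr \<sigma>"
proof -
  have "\<forall>\<^sub>F t in at_top. integral\<^sup>L (M t) (\<lambda>w. real (X t w)) \<le> 2 * t powr \<sigma>"
    using growth eventually_mean_ge eventually_gt_at_top[of 0]
    by eventually_elim (use mean_le_root_moment[OF _ p] in force)
  then obtain t0 where t0: "\<And>t. t \<ge> t0 \<Longrightarrow> integral\<^sup>L (M t) (\<lambda>w. real (X t w)) \<le> 2 * t powr \<sigma>"
    by (auto simp: eventually_at_top_linorder)
  \<comment> \<open>Starting at 1 or later keeps the points positive for differentiating
    \<open>powr\<close>, and gives t^\<sigma> \<ge> 1, which absorbs the constant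
    \<open>h t1\<close> at the end.\<close>
  define t1 where "t1 = max t0 1"
  define h where "h t = ln (eval_fps f t) - 2 / \<sigma> * t powr \<sigma>" for t
  have h: "h t \<le> h t1" if "t \<ge> t1" for t
  proof (rule DERIV_nonpos_imp_nonincreasing[OF that], intro exI conjI)
    fix x assume x: "t1 \<le> x" "x \<le> t"
    then have "x > 0"
      by (simp add: t1_def)
    have pos: "eval_fps f x > 0"
      using \<open>x > 0\<close> by (simp add: eval_pos)
    have D: "(eval_fps f has_field_derivative eval_fps (fps_deriv f) x) (at x)"
      using entire by (intro has_field_derivative_eval_fps) (simp add: entire_fps_def)
    show "(h has_real_derivative eval_fps (fps_deriv f) x / eval_fps f x - 2 * x powr (\<sigma> - 1)) (at x)"
      unfolding h_def using \<open>x > 0\<close> pos \<sigma>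
      by (auto intro!: derivative_eq_intros D)
    have "x * (2 * x powr (\<sigma> - 1)) = 2 * x powr \<sigma>"
      using powr_mult_base[of x "\<sigma> - 1"] \<open>x > 0\<close> by simp
    then have "x * (eval_fps (fps_deriv f) x / eval_fps f x) \<le> x * (2 * x powr (\<sigma> - 1))"
      using t0[of x] x \<open>x > 0\<close> by (simp add: t1_def expectation_mean)
    then show "eval_fps (fps_deriv f) x / eval_fps f x - 2 * x powr (\<sigma> - 1) \<le> 0"
      using \<open>x > 0\<close> by (simp only: mult_le_cancel_left_pos diff_le_0_iff_le)
  qed
  have "\<forall>\<^sub>F t in at_top. ln (eval_fps f t) \<le> (\<bar>h t1\<bar> + 2 / \<sigma>) * t powr \<sigma>"
    using eventually_ge_at_top[of t1]
  proof eventually_elim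
    case (elim t)
    have "\<bar>h t1\<bar> * 1 \<le> \<bar>h t1\<bar> * t powr \<sigma>"
      using elim \<sigma> by (intro mult_left_mono ge_one_powr_ge_zero) (auto simp: t1_def)
    then show ?case
      using h[OF elim] by (simp add: h_def[of t] algebra_simps)
  qed
  then show ?thesis ..
qed

end

theorem theorem5p1:
  fixes f :: "real fps" and M :: "real \<Rightarrow> 'w measure" and X :: "real \<Rightarrow> 'w \<Rightarrow> nat"
    and p :: real
  assumes "f \<in> class_K" and "entire_fps f"
    and "khinchin_family f M X"
    and "p \<ge> 1"
  shows "Limsup at_top
           (\<lambda>t::real. ereal (ln ((prob_space.expectation (M t) (\<lambda>w. real (X t w) powr p))
                                    powr (1 / p)) / ln t))
         = order_entire (complex_fun f)"
proof -
  interpret entire_khinchin_family f M X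
    using assms by unfold_locales
  \<comment> \<open>These two eventual lower bounds play both roles in the comparison of exponents:
    the constant \<open>c\<close> for one function and positivity of the other.\<close>
  have ln_ge: "\<forall>\<^sub>F t in at_top. ln (eval_fps f t) \<ge> 1"
    using eventually_eval_ge[of "exp 1"] eventually_ge_at_top[of 0]
    by eventually_elim (simp add: ln_ge_iff eval_pos)
  \<comment> \<open>The value 1/4 is the lower bound 1/2 for the mean, halved by the factor 2 in
    \<open>mean_le_root_moment\<close>.\<close>
  have moment_ge: "\<forall>\<^sub>F t in at_top.
      integral\<^sup>L (M t) (\<lambda>w. real (X t w) powr p) powr (1 / p) \<ge> 1 / 4"
    using eventually_mean_ge eventually_gt_at_top[of 0]
    by eventually_elim (use mean_le_root_moment[OF _ \<open>p \<ge> 1\<close>] in force)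
  show ?thesis
    unfolding order_entire_eq
  proof (rule antisym)
    show "Limsup at_top (\<lambda>t. ereal (ln (integral\<^sup>L (M t) (\<lambda>w. real (X t w) powr p) powr (1 / p)) / ln t))
        \<le> Limsup at_top (\<lambda>t. ereal (ln (ln (eval_fps f t)) / ln t))"
      using root_moment_growth[OF \<open>p \<ge> 1\<close>] moment_ge
      by (intro Limsup_ln_div_ln_le[OF zero_less_one ln_ge]) (auto elim: eventually_mono)
    show "Limsup at_top (\<lambda>t. ereal (ln (ln (eval_fps f t)) / ln t))
        \<le> Limsup at_top (\<lambda>t. ereal (ln (integral\<^sup>L (M t) (\<lambda>w. real (X t w) powr p) powr (1 / p)) / ln t))"
      using ln_eval_growth[OF \<open>p \<ge> 1\<close>] ln_ge
      by (intro Limsup_ln_div_ln_le[OF _ moment_ge]) (auto elim: eventually_mono)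
  qed
qed

end
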